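(* Fix $N,d\in\mathbb{N}$ with $N,d\ge1$, $L>0$, $R>0$, and real step sizes $h=(h^{(i)}_k)_{0\le k<i\le N}$. Let $f\in C^{1,1}_L(\mathbb{R}^d)$ be convex and attain its minimum value $f^\ast$, and let $x_0\in\mathbb{R}^d$ be such that $\|x_\ast-x_0\|\le R$ for some minimizer $x_\ast$ of $f$. Let $x_1,\dots,x_N$ be generated by Algorithm FO: $$x_{i+1}=x_i-\frac1L\sum_{k=0}^{i}h^{(i+1)}_k f'(x_k),\qquad i=0,\dots,N-1.$$ Suppose that the semidefinite program (DQ$'$) defined in the context is solvable for the given step sizes, i.e. its minimum is finite and attained, and let $\operatorname{val}(\mathrm{DQ}')$ be its optimal value. Then $$f(x_N)-f^\ast\le LR^2\operatorname{val}(\mathrm{DQ}').$$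
   Context: $\|\cdot\|$ is the Euclidean norm, $f'(x)$ is the gradient of $f$ at $x$, and $C^{1,1}_L(\mathbb{R}^d)$ is the class of continuously differentiable functions with $\|f'(x)-f'(y)\|\le L\|x-y\|$ for all $x,y\in\mathbb{R}^d$. Let $u_i=e_{i+1}\in\mathbb{R}^{N+1}$, $i=0,\dots,N$, be the canonical unit vectors. Define the symmetric $(N+1)\times(N+1)$ matrices $$\tilde A_{i-1,i}=\tfrac12(u_{i-1}-u_i)(u_{i-1}-u_i)^T+\tfrac12\sum_{k=0}^{i-1}h^{(i)}_k(u_iu_k^T+u_ku_i^T),\quad i=1,\dots,N,$$ $$\tilde D_i=\tfrac12u_iu_i^T+\tfrac12\sum_{t=1}^{i}\sum_{k=0}^{t-1}h^{(t)}_k(u_iu_k^T+u_ku_i^T),\quad i=0,\dots,N.$$ Let $$\tilde\Lambda=\{(\lambda,\tau)\in\mathbb{R}^N_+\times\mathbb{R}^{N+1}_+:\ \tau_0=\lambda_1,\ \lambda_i-\lambda_{i+1}+\tau_i=0\ (i=1,\dots,N-1),\ \lambda_N+\tau_N=1\},$$ where $\lambda=(\lambda_1,\dots,\lambda_N)$ and $\tau=(\tau_0,\dots,\tau_N)^T$. The problem (DQ$'$) is $$\min_{\lambda,\tau,t}\left\{\tfrac12t:\ \begin{pmatrix}\sum_{i=1}^N\lambda_i\tilde A_{i-1,i}+\sum_{i=0}^N\tau_i\tilde D_i&\tfrac12\tau\\ \tfrac12\tau^T&\tfrac12t\end{pmatrix}\succeq0,\ (\lambda,\tau)\in\tilde\Lambda\right\},$$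 with $t\in\mathbb{R}$, where $\succeq 0$ means positive semidefinite. *)

theory Defs
  imports "HOL-Analysis.Analysis" "Jordan_Normal_Form.Matrix"
begin

text \<open>Both imports declare \<open>vec\<close>, \<open>mat\<close>, the index notation and the
  dot product notation. In this theory matrices are those of \<^theory>\<open>Jordan_Normal_Form.Matrix\<close>,
  whose dimensions are terms, whereas the space \<open>\<real>\<^sup>d\<close> is the type \<^typ>\<open>real ^ 'd\<close>.\<close>

definition grad :: "('a::real_inner \<Rightarrow> real) \<Rightarrow> 'a \<Rightarrow> 'a" where
  "grad f x = (THE D. GDERIV f x :> D)"

lemma GDERIV_unique:
  assumes "GDERIV f x :> D" "GDERIV f x :> E"
  shows "D = E"
proof -
  have "(\<lambda>h. inner h D) = (\<lambda>h. inner h E)"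
    using assms unfolding gderiv_def by (rule has_derivative_unique)
  then have "inner (D - E) D = inner (D - E) E"
    by (rule fun_cong)
  then have "inner (D - E) (D - E) = 0"
    by (simp add: inner_diff_right)
  then show ?thesis
    by simp
qed

lemma grad_eq: "GDERIV f x :> D \<Longrightarrow> grad f x = D"
  unfolding grad_def by (rule the_equality) (simp_all add: GDERIV_unique)

lemma GDERIV_grad:
  fixes f :: "'a::euclidean_space \<Rightarrow> real"
  assumes "f differentiable (at x)"
  shows "GDERIV f x :> grad f x"
proof -
  obtain f' where f': "(f has_derivative f') (at x)"
    using assms unfolding differentiable_def by blast
  then interpret linear f'
    by (rule has_derivative_linear)
  have f'_eq: "f' h = inner h (adjoint f' 1)" for h
    using adjoint_works[OF linear_axioms, of h 1] by simp
  then have "GDERIV f x :> adjoint f' 1"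
    using f' by (simp add: gderiv_def flip: f'_eq)
  then show ?thesis
    by (simp add: grad_eq)
qed

definition C11 :: "real \<Rightarrow> ('a::euclidean_space \<Rightarrow> real) set" where
  "C11 L = {f. (\<forall>x. f differentiable (at x)) \<and> continuous_on UNIV (grad f) \<and>
               (\<forall>x y. norm (grad f x - grad f y) \<le> L * norm (x - y))}"

definition outer :: "real Matrix.vec \<Rightarrow> real Matrix.vec \<Rightarrow> real mat" where
  "outer v w = Matrix.mat (dim_vec v) (dim_vec w) (\<lambda>(a, b). vec_index v a * vec_index w b)"

text \<open>Finite sums of \<open>n \<times> n\<close> matrices; the type of matrices of all dimensions has no
  zero, so the overloaded sum is not available.\<close>

definition msum :: "nat \<Rightarrow> ('i \<Rightarrow> real mat) \<Rightarrow> 'i set \<Rightarrow> real mat" where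
  "msum n F I = Matrix.mat n n (\<lambda>p. \<Sum>i\<in>I. F i $$ p)"

definition psd :: "real mat \<Rightarrow> bool" where
  "psd A \<longleftrightarrow> square_mat A \<and> transpose_mat A = A \<and>
     (\<forall>v \<in> carrier_vec (dim_row A). 0 \<le> scalar_prod v (A *\<^sub>v v))"

text \<open>Vectors are indexed from \<open>0\<close>, so \<open>u\<^sub>i = e\<^bsub>i+1\<^esub>\<close> is \<open>unit_vec (N + 1) i\<close>.
  The step size \<open>h\<^sub>k\<close> with upper index \<open>i\<close> is \<open>h i k\<close>; only its values for \<open>k < i \<le> N\<close> are used.\<close>

abbreviation uvec :: "nat \<Rightarrow> nat \<Rightarrow> real Matrix.vec" where
  "uvec N i \<equiv> unit_vec (N + 1) i"

definition sym_outer :: "nat \<Rightarrow> nat \<Rightarrow> nat \<Rightarrow> real mat" where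
  "sym_outer N i k = outer (uvec N i) (uvec N k) + outer (uvec N k) (uvec N i)"

text \<open>\<open>A_mat N h i\<close> is the matrix with indices \<open>i - 1, i\<close>, for \<open>1 \<le> i \<le> N\<close>.\<close>

definition A_mat :: "nat \<Rightarrow> (nat \<Rightarrow> nat \<Rightarrow> real) \<Rightarrow> nat \<Rightarrow> real mat" where
  "A_mat N h i =
     (1/2) \<cdot>\<^sub>m outer (uvec N (i - 1) - uvec N i) (uvec N (i - 1) - uvec N i) +
     (1/2) \<cdot>\<^sub>m msum (N + 1) (\<lambda>k. h i k \<cdot>\<^sub>m sym_outer N i k) {0..<i}"

definition D_mat :: "nat \<Rightarrow> (nat \<Rightarrow> nat \<Rightarrow> real) \<Rightarrow> nat \<Rightarrow> real mat" where
  "D_mat N h i =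
     (1/2) \<cdot>\<^sub>m outer (uvec N i) (uvec N i) +
     (1/2) \<cdot>\<^sub>m msum (N + 1)
       (\<lambda>t. msum (N + 1) (\<lambda>k. h t k \<cdot>\<^sub>m sym_outer N i k) {0..<t}) {1..i}"

text \<open>The multipliers \<open>(\<lambda>\<^sub>1, \<dots>, \<lambda>\<^sub>N)\<close> and \<open>(\<tau>\<^sub>0, \<dots>, \<tau>\<^sub>N)\<close> are
  functions on \<^typ>\<open>nat\<close>, whose values at other indices are irrelevant.\<close>

definition Lambda :: "nat \<Rightarrow> ((nat \<Rightarrow> real) \<times> (nat \<Rightarrow> real)) set" where
  "Lambda N = {(lam, tau).
     (\<forall>i\<in>{1..N}. 0 \<le> lam i) \<and> (\<forall>i\<in>{0..N}. 0 \<le> tau i) \<and>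
     tau 0 = lam 1 \<and>
     (\<forall>i\<in>{1..<N}. lam i - lam (i + 1) + tau i = 0) \<and>
     lam N + tau N = 1}"

definition dq_block :: "nat \<Rightarrow> (nat \<Rightarrow> nat \<Rightarrow> real) \<Rightarrow>
    (nat \<Rightarrow> real) \<Rightarrow> (nat \<Rightarrow> real) \<Rightarrow> real \<Rightarrow> real mat" where
  "dq_block N h lam tau t =
     (let tau_col = Matrix.mat (N + 1) 1 (\<lambda>(i, _). tau i) in
      four_block_mat
        (msum (N + 1) (\<lambda>i. lam i \<cdot>\<^sub>m A_mat N h i) {1..N} +
         msum (N + 1) (\<lambda>i. tau i \<cdot>\<^sub>m D_mat N h i) {0..N})
        ((1/2) \<cdot>\<^sub>m tau_col)
        ((1/2) \<cdot>\<^sub>m transpose_mat tau_col)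
        (Matrix.mat 1 1 (\<lambda>_. t / 2)))"

definition dq_feasible :: "nat \<Rightarrow> (nat \<Rightarrow> nat \<Rightarrow> real) \<Rightarrow>
    ((nat \<Rightarrow> real) \<times> (nat \<Rightarrow> real) \<times> real) set" where
  "dq_feasible N h = {(lam, tau, t). psd (dq_block N h lam tau t) \<and> (lam, tau) \<in> Lambda N}"

definition dq_objective :: "(nat \<Rightarrow> real) \<times> (nat \<Rightarrow> real) \<times> real \<Rightarrow> real" where
  "dq_objective = (\<lambda>(lam, tau, t). t / 2)"

definition dq_solvable :: "nat \<Rightarrow> (nat \<Rightarrow> nat \<Rightarrow> real) \<Rightarrow> bool" where
  "dq_solvable N h \<longleftrightarrow> (\<exists>z. is_arg_min dq_objective (\<lambda>z. z \<in> dq_feasible N h) z)"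

definition dq_val :: "nat \<Rightarrow> (nat \<Rightarrow> nat \<Rightarrow> real) \<Rightarrow> real" where
  "dq_val N h = (INF z\<in>dq_feasible N h. dq_objective z)"

end

theory Submission
  imports Defs
begin

text \<open>
  Write \<open>g\<^sub>i\<close> for the gradient at \<open>x\<^sub>i\<close>, \<open>\<delta>\<^sub>i = f(x\<^sub>i) - f\<^sup>*\<close> and \<open>\<nu> = x\<^sup>* - x\<^sub>0\<close>. A convex function with
  \<open>L\<close>-Lipschitz gradient satisfies the cocoercivity inequality
  \<open>f(b) + \<langle>f'(b), a - b\<rangle> + \<parallel>f'(a) - f'(b)\<parallel>\<^sup>2 / (2L) \<le> f(a)\<close> (lemma \<open>C11_cocoercive\<close>). Take it
  at the pairs \<open>(a, b) = (x\<^bsub>i-1\<^esub>, x\<^sub>i)\<close> and \<open>(a, b) = (x\<^sup>*, x\<^sub>i)\<close>, where \<open>f'(x\<^sup>*) = 0\<close>, and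
  eliminate all differences of iterates by the recursion. What remains is linear in the \<open>\<delta>\<^sub>i\<close> and the Gram matrix of the \<open>g\<^sub>i\<close> and \<open>\<nu>\<close>:
  the first pair gives \<open>\<delta>\<^sub>i - \<delta>\<^bsub>i-1\<^esub> + q(A\<^sub>i)/L \<le> 0\<close> and the second
  \<open>\<delta>\<^sub>i + \<langle>g\<^sub>i, \<nu>\<rangle> + q(D\<^sub>i)/L \<le> 0\<close>, where \<open>q(M) = \<Sum> M\<^bsub>ab\<^esub> \<langle>g\<^sub>a, g\<^sub>b\<rangle>\<close>. This is where the matrices
  of the semidefinite program come from.

  Up to the factor \<open>L R\<^sup>2\<close>, the program is the Lagrangian dual of maximizing \<open>\<delta>\<^sub>N\<close> over Gram matrices
  subject to these inequalities and \<open>\<parallel>\<nu>\<parallel> \<le> R\<close>, so the bound is weak duality. Multiply the first family by \<open>\<lambda>\<^sub>i\<close>, the second by \<open>\<tau>\<^sub>i\<close>, and add: the linear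
  constraints on the multipliers make the \<open>\<delta>\<close>-terms collapse to \<open>\<delta>\<^sub>N\<close> (lemma \<open>Lambda_telescope\<close>).
  Positive semidefiniteness of the block matrix, tested on the vectors
  \<open>g\<^sub>0, \<dots>, g\<^sub>N, L\<nu>\<close>, says that the rest is at least \<open>-L t \<parallel>\<nu>\<parallel>\<^sup>2 / 2\<close>. Hence
  \<open>\<delta>\<^sub>N \<le> L R\<^sup>2 t / 2\<close> for every feasible point, in particular for an optimal one.
\<close>

section \<open>Convex functions with Lipschitz gradient\<close>

lemma C11_GDERIV:
  assumes "f \<in> C11 L"
  shows "GDERIV f x :> grad f x"
  using assms by (auto simp: C11_def intro: GDERIV_grad)

lemma C11_lipschitz:
  assumes "f \<in> C11 L"
  shows "norm (grad f x - grad f y) \<le> L * norm (x - y)"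
  using assms by (simp add: C11_def)

lemma C11_DERIV_line:
  fixes a v :: "'a::euclidean_space"
  assumes "f \<in> C11 L"
  shows "((\<lambda>s. f (a + s *\<^sub>R v)) has_real_derivative inner v (grad f (a + s *\<^sub>R v))) (at s within S)"
proof -
  have "((\<lambda>s. a + s *\<^sub>R v) has_derivative (\<lambda>t. t *\<^sub>R v)) (at s within S)"
    by (auto intro!: derivative_eq_intros)
  moreover have "(f has_derivative (\<lambda>u. inner u (grad f (a + s *\<^sub>R v)))) (at (a + s *\<^sub>R v))"
    using C11_GDERIV[OF assms] by (simp add: gderiv_def)
  ultimately have "((\<lambda>s. f (a + s *\<^sub>R v)) has_derivative
      (\<lambda>t. inner (t *\<^sub>R v) (grad f (a + s *\<^sub>R v)))) (at s within S)"
    by (rule has_derivative_compose)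
  then show ?thesis
    by (simp add: has_field_derivative_def mult_commute_abs)
qed

lemma C11_convex_above_tangent:
  fixes f :: "'a::euclidean_space \<Rightarrow> real"
  assumes "f \<in> C11 L" "convex_on UNIV f"
  shows "f a + inner (grad f a) (b - a) \<le> f b"
proof -
  define \<phi> where "\<phi> = (\<lambda>s::real. f (a + s *\<^sub>R (b - a)))"
  have "convex_on UNIV \<phi>"
  proof (rule convex_onI)
    fix t r s :: real
    assume "0 < t" "t < 1"
    have "a + ((1 - t) *\<^sub>R r + t *\<^sub>R s) *\<^sub>R (b - a) =
        (1 - t) *\<^sub>R (a + r *\<^sub>R (b - a)) + t *\<^sub>R (a + s *\<^sub>R (b - a))"
      by (simp add: algebra_simps)
    then show "\<phi> ((1 - t) *\<^sub>R r + t *\<^sub>R s) \<le> (1 - t) * \<phi> r + t * \<phi> s"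
      using convex_onD[OF assms(2), of t "a + r *\<^sub>R (b - a)" "a + s *\<^sub>R (b - a)"]
        \<open>0 < t\<close> \<open>t < 1\<close>
      by (simp add: \<phi>_def)
  qed simp
  moreover have "(\<phi> has_real_derivative inner (b - a) (grad f a)) (at 0 within UNIV)"
    using C11_DERIV_line[OF assms(1), of a "b - a" 0 UNIV] by (simp add: \<phi>_def)
  ultimately have "\<phi> 1 - \<phi> 0 \<ge> inner (b - a) (grad f a) * (1 - 0)"
    by (intro convex_on_imp_above_tangent[where A = UNIV]) auto
  then show ?thesis
    by (simp add: \<phi>_def inner_commute)
qed

text \<open>The gap between \<open>f\<close> and its quadratic model along the segment from \<open>a\<close> to \<open>b\<close> has
  nonpositive derivative, because the gradient moves by at most \<open>L s \<parallel>b - a\<parallel>\<close> in time \<open>s\<close>.\<close>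

lemma C11_descent:
  fixes f :: "'a::euclidean_space \<Rightarrow> real"
  assumes "f \<in> C11 L"
  shows "f b \<le> f a + inner (grad f a) (b - a) + L / 2 * (norm (b - a))\<^sup>2"
proof -
  define v where "v = b - a"
  define \<phi> where "\<phi> = (\<lambda>s. f (a + s *\<^sub>R v) - s * inner v (grad f a) - L / 2 * s\<^sup>2 * (norm v)\<^sup>2)"
  have "\<phi> 1 \<le> \<phi> 0"
  proof (rule DERIV_nonpos_imp_nonincreasing[OF zero_le_one])
    fix s :: real
    assume s: "0 \<le> s" "s \<le> 1"
    let ?D = "inner v (grad f (a + s *\<^sub>R v)) - inner v (grad f a) - L * s * (norm v)\<^sup>2"
    have "(\<phi> has_real_derivative ?D) (at s)"
    proof -
      have "((\<lambda>s. s * inner v (grad f a)) has_real_derivative inner v (grad f a)) (at s)"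
        by (auto intro!: derivative_eq_intros)
      moreover have "((\<lambda>s. L / 2 * s\<^sup>2 * (norm v)\<^sup>2) has_real_derivative L * s * (norm v)\<^sup>2) (at s)"
        by (auto intro!: derivative_eq_intros)
      ultimately show ?thesis
        unfolding \<phi>_def by (intro DERIV_diff C11_DERIV_line[OF assms])
    qed
    moreover have "?D \<le> 0"
    proof -
      have "inner v (grad f (a + s *\<^sub>R v) - grad f a) \<le> norm v * norm (grad f (a + s *\<^sub>R v) - grad f a)"
        by (rule norm_cauchy_schwarz)
      also have "\<dots> \<le> norm v * (L * norm ((a + s *\<^sub>R v) - a))"
        using C11_lipschitz[OF assms, of "a + s *\<^sub>R v" a] by (rule mult_left_mono) simp
      also have "\<dots> = L * s * (norm v)\<^sup>2"
        using s by (simp add: power2_eq_square)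
      finally show ?thesis
        by (simp add: inner_diff_right)
    qed
    ultimately show "\<exists>D. DERIV \<phi> s :> D \<and> D \<le> 0"
      by blast
  qed
  then show ?thesis
    by (simp add: \<phi>_def v_def inner_commute)
qed

text \<open>The tangent at \<open>b\<close> lies below \<open>f\<close>, and \<open>f\<close> lies below the quadratic model at \<open>a\<close>. Both
  are compared at the point \<open>a - (f'(a) - f'(b)) / L\<close>, which minimizes the difference of the model
  and the tangent.\<close>

lemma C11_cocoercive:
  fixes f :: "'a::euclidean_space \<Rightarrow> real"
  assumes "f \<in> C11 L" "convex_on UNIV f" "L > 0"
  shows "f b + inner (grad f b) (a - b) + (norm (grad f a - grad f b))\<^sup>2 / (2 * L) \<le> f a"
proof -
  define e where "e = grad f a - grad f b"
  define z where "z = a - (1 / L) *\<^sub>R e"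
  have "f b + inner (grad f b) (z - b) \<le> f z"
    by (rule C11_convex_above_tangent[OF assms(1,2)])
  also have "f z \<le> f a + inner (grad f a) (z - a) + L / 2 * (norm (z - a))\<^sup>2"
    by (rule C11_descent[OF assms(1)])
  also have "L / 2 * (norm (z - a))\<^sup>2 = inner e e / (2 * L)"
  proof -
    have "(norm (z - a))\<^sup>2 = inner e e / L\<^sup>2"
      unfolding power2_norm_eq_inner by (simp add: z_def power2_eq_square)
    then show ?thesis
      using \<open>L > 0\<close> by (simp add: power2_eq_square)
  qed
  also have "inner (grad f a) (z - a) = inner (grad f b) (z - a) - inner e e / L"
    by (simp add: z_def e_def inner_diff_left inner_diff_right algebra_simps add_divide_distrib
        diff_divide_distrib)
  also have "inner (grad f b) (z - a) = inner (grad f b) (z - b) - inner (grad f b) (a - b)"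
    by (simp add: inner_diff_right)
  finally have "f b + inner (grad f b) (a - b) + (inner e e / L - inner e e / (2 * L)) \<le> f a"
    by simp
  moreover have "inner e e / L - inner e e / (2 * L) = inner e e / (2 * L)"
    using \<open>L > 0\<close> by (simp add: field_simps)
  ultimately show ?thesis
    by (simp add: e_def power2_norm_eq_inner)
qed

section \<open>Matrices evaluated on Gram matrices\<close>

text \<open>The trace of \<open>A\<close> against the Gram matrix of \<open>w\<^sub>0, \<dots>, w\<^bsub>n-1\<^esub>\<close>. Keeping the \<open>w\<^sub>a\<close> as
  vectors confines the passage to coordinates to lemma \<open>psd_imp_gram_form_nonneg\<close>.\<close>

definition gram_form :: "nat \<Rightarrow> real mat \<Rightarrow> (nat \<Rightarrow> 'a::real_inner) \<Rightarrow> real" where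
  "gram_form n A w = (\<Sum>a<n. \<Sum>b<n. A $$ (a, b) * inner (w a) (w b))"

lemma gram_form_add:
  assumes "B \<in> carrier_mat n n"
  shows "gram_form n (A + B) w = gram_form n A w + gram_form n B w"
  using assms by (simp add: gram_form_def distrib_right sum.distrib)

lemma gram_form_smult:
  assumes "A \<in> carrier_mat n n"
  shows "gram_form n (c \<cdot>\<^sub>m A) w = c * gram_form n A w"
  using assms by (simp add: gram_form_def sum_distrib_left mult.assoc)

lemma gram_form_msum: "gram_form n (msum n F I) w = (\<Sum>i\<in>I. gram_form n (F i) w)"
proof -
  have "gram_form n (msum n F I) w = (\<Sum>a<n. \<Sum>b<n. \<Sum>i\<in>I. F i $$ (a, b) * inner (w a) (w b))"
    by (simp add: gram_form_def msum_def sum_distrib_right)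
  also have "\<dots> = (\<Sum>a<n. \<Sum>i\<in>I. \<Sum>b<n. F i $$ (a, b) * inner (w a) (w b))"
    by (intro sum.cong refl sum.swap)
  also have "\<dots> = (\<Sum>i\<in>I. \<Sum>a<n. \<Sum>b<n. F i $$ (a, b) * inner (w a) (w b))"
    by (rule sum.swap)
  finally show ?thesis
    by (simp add: gram_form_def)
qed

lemma gram_form_outer:
  assumes "u \<in> carrier_vec n" "v \<in> carrier_vec n"
  shows "gram_form n (outer u v) w =
    inner (\<Sum>a<n. vec_index u a *\<^sub>R w a) (\<Sum>b<n. vec_index v b *\<^sub>R w b)"
  unfolding gram_form_def inner_sum_left unfolding inner_sum_right using assms
  by (intro sum.cong refl) (simp add: outer_def)

lemma sum_unit_vec_scaleR:
  assumes "i < n"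
  shows "(\<Sum>a<n. vec_index (unit_vec n i) a *\<^sub>R w a) = (w i :: 'a::real_vector)"
proof -
  have "(\<Sum>a<n. vec_index (unit_vec n i) a *\<^sub>R w a) = (\<Sum>a<n. if a = i then w a else 0)"
    by (intro sum.cong) (auto simp: unit_vec_def)
  then show ?thesis
    using assms by simp
qed

lemma sum_unit_vec_diff_scaleR:
  assumes "i < n" "j < n"
  shows "(\<Sum>a<n. vec_index (unit_vec n i - unit_vec n j) a *\<^sub>R w a) = (w i - w j :: 'a::real_vector)"
proof -
  have "(\<Sum>a<n. vec_index (unit_vec n i - unit_vec n j) a *\<^sub>R w a) =
      (\<Sum>a<n. vec_index (unit_vec n i) a *\<^sub>R w a - vec_index (unit_vec n j) a *\<^sub>R w a)"
    by (intro sum.cong) (auto simp: scaleR_left_diff_distrib)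
  then show ?thesis
    by (simp only: sum_subtractf sum_unit_vec_scaleR[OF assms(1)] sum_unit_vec_scaleR[OF assms(2)])
qed

text \<open>A Gram matrix is the sum over an orthonormal basis of the rank one matrices formed by the
  coordinates of the vectors, and \<open>A\<close> is nonnegative on each of these.\<close>

lemma psd_imp_gram_form_nonneg:
  fixes w :: "nat \<Rightarrow> 'a::euclidean_space"
  assumes "psd A" "A \<in> carrier_mat n n"
  shows "0 \<le> gram_form n A w"
proof -
  have "0 \<le> (\<Sum>a<n. \<Sum>b<n. A $$ (a, b) * (inner (w a) e * inner (w b) e))" for e
  proof -
    define v where "v = Matrix.vec n (\<lambda>a. inner (w a) e)"
    have "0 \<le> scalar_prod v (A *\<^sub>v v)"
      using assms by (auto simp: psd_def v_def)
    also have "\<dots> = (\<Sum>a<n. \<Sum>b<n. A $$ (a, b) * (inner (w a) e * inner (w b) e))"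
      using assms(2)
      by (simp add: v_def scalar_prod_def sum_distrib_left atLeast0LessThan mult.left_commute)
    finally show ?thesis .
  qed
  then have "0 \<le> (\<Sum>e\<in>Basis. \<Sum>a<n. \<Sum>b<n. A $$ (a, b) * (inner (w a) e * inner (w b) e))"
    by (rule sum_nonneg)
  also have "\<dots> = (\<Sum>a<n. \<Sum>e\<in>Basis. \<Sum>b<n. A $$ (a, b) * (inner (w a) e * inner (w b) e))"
    by (rule sum.swap)
  also have "\<dots> = (\<Sum>a<n. \<Sum>b<n. \<Sum>e\<in>Basis. A $$ (a, b) * (inner (w a) e * inner (w b) e))"
    by (intro sum.cong refl sum.swap)
  also have "\<dots> = gram_form n A w"
    unfolding gram_form_def euclidean_inner[of "w _" "w _"] sum_distrib_left ..
  finally show ?thesis .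
qed

section \<open>The matrices of the semidefinite program\<close>

lemma outer_carrier [simp]: "u \<in> carrier_vec n \<Longrightarrow> v \<in> carrier_vec n \<Longrightarrow> outer u v \<in> carrier_mat n n"
  by (auto simp: outer_def)

lemma msum_carrier [simp]: "msum n F I \<in> carrier_mat n n"
  by (simp add: msum_def)

lemma sym_outer_carrier [simp]: "sym_outer N i k \<in> carrier_mat (N + 1) (N + 1)"
  unfolding sym_outer_def by (intro add_carrier_mat outer_carrier) auto

lemma A_mat_carrier [simp]: "A_mat N h i \<in> carrier_mat (N + 1) (N + 1)"
  unfolding A_mat_def by (intro add_carrier_mat smult_carrier_mat msum_carrier)

lemma D_mat_carrier [simp]: "D_mat N h i \<in> carrier_mat (N + 1) (N + 1)"
  unfolding D_mat_def by (intro add_carrier_mat smult_carrier_mat msum_carrier)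

lemma gram_form_sym_outer:
  assumes "i \<le> N" "k \<le> N"
  shows "gram_form (N + 1) (sym_outer N i k) w = 2 * inner (w i) (w k)"
proof -
  have "gram_form (N + 1) (sym_outer N i k) w =
      gram_form (N + 1) (outer (uvec N i) (uvec N k)) w +
      gram_form (N + 1) (outer (uvec N k) (uvec N i)) w"
    unfolding sym_outer_def by (rule gram_form_add) auto
  moreover have "gram_form (N + 1) (outer (uvec N a) (uvec N b)) w = inner (w a) (w b)"
    if "a \<le> N" "b \<le> N" for a b
    using that gram_form_outer[of "uvec N a" "N + 1" "uvec N b" w]
      sum_unit_vec_scaleR[of a "N + 1" w] sum_unit_vec_scaleR[of b "N + 1" w]
    by (simp only: unit_vec_carrier le_imp_less_Suc Suc_eq_plus1[symmetric])
  ultimately show ?thesis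
    using assms by (simp add: inner_commute)
qed

lemma gram_form_A_mat:
  assumes "1 \<le> i" "i \<le> N"
  shows "gram_form (N + 1) (A_mat N h i) w =
    (norm (w (i - 1) - w i))\<^sup>2 / 2 + inner (w i) (\<Sum>k<i. h i k *\<^sub>R w k)"
proof -
  have *: "gram_form (N + 1) (outer (uvec N (i - 1) - uvec N i) (uvec N (i - 1) - uvec N i)) w =
      (norm (w (i - 1) - w i))\<^sup>2"
  proof -
    have "i - 1 < N + 1" "i < N + 1"
      using assms by auto
    then show ?thesis
      by (simp only: gram_form_outer minus_carrier_vec unit_vec_carrier sum_unit_vec_diff_scaleR
          power2_norm_eq_inner)
  qed
  have "gram_form (N + 1) (msum (N + 1) (\<lambda>k. h i k \<cdot>\<^sub>m sym_outer N i k) {0..<i}) w =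
      (\<Sum>k<i. 2 * (h i k * inner (w i) (w k)))"
    unfolding gram_form_msum atLeast0LessThan
    using assms by (intro sum.cong refl)
      (simp add: gram_form_smult[OF sym_outer_carrier] gram_form_sym_outer
        del: One_nat_def Suc_eq_plus1 add_Suc_right)
  also have "\<dots> = 2 * inner (w i) (\<Sum>k<i. h i k *\<^sub>R w k)"
    by (simp add: inner_sum_right sum_distrib_left)
  finally have **: "gram_form (N + 1) (msum (N + 1) (\<lambda>k. h i k \<cdot>\<^sub>m sym_outer N i k) {0..<i}) w =
      2 * inner (w i) (\<Sum>k<i. h i k *\<^sub>R w k)" .
  show ?thesis
    unfolding A_mat_def
    by (simp only: gram_form_add gram_form_smult smult_carrier_mat msum_carrier outer_carrier
        minus_carrier_vec unit_vec_carrier * **)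
qed

lemma gram_form_D_mat:
  assumes "i \<le> N"
  shows "gram_form (N + 1) (D_mat N h i) w =
    (norm (w i))\<^sup>2 / 2 + inner (w i) (\<Sum>t=1..i. \<Sum>k<t. h t k *\<^sub>R w k)"
proof -
  have *: "gram_form (N + 1) (outer (uvec N i) (uvec N i)) w = (norm (w i))\<^sup>2"
  proof -
    have "i < N + 1"
      using assms by auto
    then show ?thesis
      by (simp only: gram_form_outer unit_vec_carrier sum_unit_vec_scaleR power2_norm_eq_inner)
  qed
  have "gram_form (N + 1) (msum (N + 1)
        (\<lambda>t. msum (N + 1) (\<lambda>k. h t k \<cdot>\<^sub>m sym_outer N i k) {0..<t}) {1..i}) w =
      (\<Sum>t=1..i. \<Sum>k<t. 2 * (h t k * inner (w i) (w k)))"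
    unfolding gram_form_msum atLeast0LessThan
    using assms by (intro sum.cong refl)
      (simp add: gram_form_smult[OF sym_outer_carrier] gram_form_sym_outer
        del: One_nat_def Suc_eq_plus1 add_Suc_right)
  also have "\<dots> = 2 * inner (w i) (\<Sum>t=1..i. \<Sum>k<t. h t k *\<^sub>R w k)"
    by (simp add: inner_sum_right sum_distrib_left)
  finally have **: "gram_form (N + 1) (msum (N + 1)
        (\<lambda>t. msum (N + 1) (\<lambda>k. h t k \<cdot>\<^sub>m sym_outer N i k) {0..<t}) {1..i}) w =
      2 * inner (w i) (\<Sum>t=1..i. \<Sum>k<t. h t k *\<^sub>R w k)" .
  show ?thesis
    unfolding D_mat_def
    by (simp only: gram_form_add gram_form_smult smult_carrier_mat msum_carrier outer_carrier
        minus_carrier_vec unit_vec_carrier * **)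
qed

lemma dq_block_carrier: "dq_block N h lam tau t \<in> carrier_mat (N + 2) (N + 2)"
proof -
  have "dq_block N h lam tau t \<in> carrier_mat ((N + 1) + 1) ((N + 1) + 1)"
    unfolding dq_block_def Let_def
    by (intro four_block_carrier_mat add_carrier_mat msum_carrier mat_carrier)
  then show ?thesis
    by simp
qed

lemma gram_form_dq_block:
  "gram_form (N + 2) (dq_block N h lam tau t) w =
    (\<Sum>i=1..N. lam i * gram_form (N + 1) (A_mat N h i) w) +
    (\<Sum>i=0..N. tau i * gram_form (N + 1) (D_mat N h i) w) +
    inner (\<Sum>i=0..N. tau i *\<^sub>R w i) (w (N + 1)) + t / 2 * (norm (w (N + 1)))\<^sup>2"
proof -
  let ?B = "dq_block N h lam tau t"
  let ?S = "msum (N + 1) (\<lambda>i. lam i \<cdot>\<^sub>m A_mat N h i) {1..N} +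
    msum (N + 1) (\<lambda>i. tau i \<cdot>\<^sub>m D_mat N h i) {0..N}"
  have entries: "?B $$ (a, b) = ?S $$ (a, b)" "?B $$ (a, N + 1) = tau a / 2"
    "?B $$ (N + 1, b) = tau b / 2" "?B $$ (N + 1, N + 1) = t / 2"
    if "a < N + 1" "b < N + 1" for a b
    using that by (simp_all add: dq_block_def Let_def msum_def)
  have cross: "(\<Sum>a<N + 1. tau a / 2 * inner (w a) (w (N + 1))) =
      inner (\<Sum>i=0..N. tau i *\<^sub>R w i) (w (N + 1)) / 2"
    by (simp add: inner_sum_left sum_divide_distrib lessThan_Suc_atMost atLeast0AtMost
        del: sum.lessThan_Suc)
  have split: "gram_form (N + 2) ?B w =
      (\<Sum>a<N + 1. (\<Sum>b<N + 1. ?B $$ (a, b) * inner (w a) (w b)) +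
        ?B $$ (a, N + 1) * inner (w a) (w (N + 1))) +
      ((\<Sum>b<N + 1. ?B $$ (N + 1, b) * inner (w (N + 1)) (w b)) +
        ?B $$ (N + 1, N + 1) * inner (w (N + 1)) (w (N + 1)))"
  proof -
    have "N + 2 = Suc (N + 1)"
      by simp
    then show ?thesis
      unfolding gram_form_def by (simp only: sum.lessThan_Suc)
  qed
  have "gram_form (N + 2) ?B w =
      gram_form (N + 1) ?S w + inner (\<Sum>i=0..N. tau i *\<^sub>R w i) (w (N + 1)) +
      t / 2 * (norm (w (N + 1)))\<^sup>2"
  proof -
    have rows: "(\<Sum>a<N + 1. (\<Sum>b<N + 1. ?B $$ (a, b) * inner (w a) (w b)) +
          ?B $$ (a, N + 1) * inner (w a) (w (N + 1))) =
        gram_form (N + 1) ?S w + (\<Sum>a<N + 1. tau a / 2 * inner (w a) (w (N + 1)))"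
      unfolding gram_form_def sum.distrib[symmetric]
      by (intro sum.cong refl arg_cong2[where f = "(+)"]) (simp_all only: entries lessThan_iff)
    have last_row: "(\<Sum>b<N + 1. ?B $$ (N + 1, b) * inner (w (N + 1)) (w b)) =
        (\<Sum>a<N + 1. tau a / 2 * inner (w a) (w (N + 1)))"
      by (intro sum.cong refl) (simp only: entries lessThan_iff inner_commute)
    have corner: "?B $$ (N + 1, N + 1) = t / 2"
      using entries(4)[of 0 0] by simp
    show ?thesis
      unfolding split rows last_row corner cross power2_norm_eq_inner by simp
  qed
  moreover have "gram_form (N + 1) ?S w =
      (\<Sum>i=1..N. lam i * gram_form (N + 1) (A_mat N h i) w) +
      (\<Sum>i=0..N. tau i * gram_form (N + 1) (D_mat N h i) w)"
    by (simp only: gram_form_add[OF msum_carrier] gram_form_msum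
        gram_form_smult[OF A_mat_carrier] gram_form_smult[OF D_mat_carrier])
  ultimately show ?thesis
    by simp
qed

text \<open>The diagonal entry \<open>t / 2\<close> of a positive semidefinite matrix is nonnegative. This is what
  lets the distance to the minimizer be replaced by its upper bound \<open>R\<close>.\<close>

lemma dq_feasible_nonneg:
  assumes "(lam, tau, t) \<in> dq_feasible N h"
  shows "0 \<le> t"
proof -
  have "0 \<le> gram_form (N + 2) (dq_block N h lam tau t) (\<lambda>i. if i = N + 1 then 1 else (0::real))"
    using assms by (intro psd_imp_gram_form_nonneg dq_block_carrier) (auto simp: dq_feasible_def)
  also have "\<dots> = t / 2"
  proof -
    have "gram_form (N + 1) M (\<lambda>i. if i = N + 1 then 1 else (0::real)) = 0" for M
      by (auto simp: gram_form_def intro!: sum.neutral)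
    then show ?thesis
      by (simp only: gram_form_dq_block) (simp add: sum.neutral)
  qed
  finally show ?thesis
    by simp
qed

section \<open>Weak duality\<close>

text \<open>Summation by parts; the constraints defining the multiplier set say that the coefficient of
  each \<open>\<delta>\<^sub>i\<close> with \<open>i < N\<close> vanishes and that of \<open>\<delta>\<^sub>N\<close> is one.\<close>

lemma Lambda_telescope:
  assumes "(lam, tau) \<in> Lambda N" "1 \<le> N"
  shows "(\<Sum>i=1..N. lam i * (\<delta> i - \<delta> (i - 1))) + (\<Sum>i=0..N. tau i * \<delta> i) = (\<delta> N :: real)"
proof -
  have tau: "lam i - lam (i + 1) + tau i = 0" if "1 \<le> i" "i < N" for i
    using assms(1) that by (auto simp: Lambda_def)
  have partial: "(\<Sum>i=1..n. lam i * (\<delta> i - \<delta> (i - 1))) + (\<Sum>i=0..<n. tau i * \<delta> i) = lam n * \<delta> n"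
    if "1 \<le> n" "n \<le> N" for n
    using that
  proof (induction n rule: dec_induct)
    case base
    then show ?case
      using assms by (simp add: Lambda_def algebra_simps)
  next
    case (step n)
    then have "lam (Suc n) = lam n + tau n"
      using tau[of n] by simp
    then show ?case
      using step by (simp add: algebra_simps)
  qed
  have "(\<Sum>i=0..N. tau i * \<delta> i) = (\<Sum>i=0..<N. tau i * \<delta> i) + tau N * \<delta> N"
    by (simp add: atLeastLessThanSuc_atLeastAtMost[symmetric])
  then have "(\<Sum>i=1..N. lam i * (\<delta> i - \<delta> (i - 1))) + (\<Sum>i=0..N. tau i * \<delta> i) =
      (lam N + tau N) * \<delta> N"
    using partial[of N] assms(2) by (simp add: distrib_right)
  moreover have "lam N + tau N = 1"
    using assms(1) by (simp add: Lambda_def)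
  ultimately show ?thesis
    by simp
qed

text \<open>The bound certified by an arbitrary feasible point. Each multiplier is nonnegative, so it
  preserves the inequality that it weights.\<close>

lemma first_order_bound:
  fixes f :: "'a::euclidean_space \<Rightarrow> real"
  assumes "1 \<le> N" "0 < L" "f \<in> C11 L" "convex_on UNIV f"
    and min: "\<forall>y. f xstar \<le> f y"
    and dist: "norm (xstar - x 0) \<le> R"
    and rec: "\<forall>i<N. x (i + 1) = x i - (1 / L) *\<^sub>R (\<Sum>k=0..i. h (i + 1) k *\<^sub>R grad f (x k))"
    and feas: "(lam, tau, t) \<in> dq_feasible N h"
  shows "f (x N) - f xstar \<le> L * R\<^sup>2 * (t / 2)"
proof -
  define g where "g i = grad f (x i)" for i
  define \<nu> where "\<nu> = xstar - x 0"
  define \<delta> where "\<delta> i = f (x i) - f xstar" for i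
  \<comment> \<open>The last vector carries the factor \<open>L\<close> because the quadratic terms of the inequalities are
    divided by \<open>L\<close> and their cross terms with \<open>\<nu>\<close> are not.\<close>
  define w where "w i = (if i \<le> N then g i else L *\<^sub>R \<nu>)" for i
  define qA where "qA i = gram_form (N + 1) (A_mat N h i) w" for i
  define qD where "qD i = gram_form (N + 1) (D_mat N h i) w" for i
  have Lam: "(lam, tau) \<in> Lambda N" and psd: "psd (dq_block N h lam tau t)"
    using feas by (auto simp: dq_feasible_def)
  have step: "x (i - 1) - x i = (1 / L) *\<^sub>R (\<Sum>k<i. h i k *\<^sub>R w k)" if "1 \<le> i" "i \<le> N" for i
  proof -
    have "x (i - 1) - x i = (1 / L) *\<^sub>R (\<Sum>k=0..i - 1. h i k *\<^sub>R g k)"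
      using rec[rule_format, of "i - 1"] that by (simp add: g_def)
    also have "{0..i - 1} = {..<i}"
      using that by auto
    also have "(\<Sum>k<i. h i k *\<^sub>R g k) = (\<Sum>k<i. h i k *\<^sub>R w k)"
      using that by (intro sum.cong) (auto simp: w_def)
    finally show ?thesis .
  qed
  have steps: "x 0 - x i = (1 / L) *\<^sub>R (\<Sum>t=1..i. \<Sum>k<t. h t k *\<^sub>R w k)" if "i \<le> N" for i
    using that
  proof (induction i)
    case (Suc i)
    have "x 0 - x (Suc i) = (x 0 - x i) + (x (Suc i - 1) - x (Suc i))"
      by simp
    with Suc step[of "Suc i"] show ?case
      by (simp add: scaleR_add_right del: sum.lessThan_Suc)
  qed simp
  have ineqA: "\<delta> i - \<delta> (i - 1) \<le> - (qA i / L)" if i: "1 \<le> i" "i \<le> N" for i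
  proof -
    have "f (x i) + inner (g i) (x (i - 1) - x i) + (norm (g (i - 1) - g i))\<^sup>2 / (2 * L) \<le> f (x (i - 1))"
      unfolding g_def by (rule C11_cocoercive) (use assms in auto)
    moreover have "qA i / L = inner (g i) (x (i - 1) - x i) + (norm (g (i - 1) - g i))\<^sup>2 / (2 * L)"
      unfolding qA_def gram_form_A_mat[OF i] step[OF i]
      using i by (simp add: w_def add_divide_distrib)
    ultimately show ?thesis
      by (simp add: \<delta>_def)
  qed
  have ineqD: "\<delta> i \<le> - (qD i / L) - inner (g i) \<nu>" if i: "i \<le> N" for i
  proof -
    have "GDERIV f xstar :> grad f xstar"
      by (rule C11_GDERIV[OF assms(3)])
    then have "(\<lambda>u. inner u (grad f xstar)) = (\<lambda>u. 0)"
      unfolding gderiv_def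
      by (rule has_derivative_local_min[where f = f]) (simp add: min)
    then have "inner (grad f xstar) (grad f xstar) = 0"
      by (rule fun_cong)
    then have "grad f xstar = 0"
      by simp
    then have "f (x i) + inner (g i) (xstar - x i) + (norm (g i))\<^sup>2 / (2 * L) \<le> f xstar"
      using C11_cocoercive[OF assms(3,4,2), of "x i" xstar] by (simp add: g_def)
    moreover have "xstar - x i = \<nu> + (x 0 - x i)"
      by (simp add: \<nu>_def)
    moreover have "qD i / L = inner (g i) (x 0 - x i) + (norm (g i))\<^sup>2 / (2 * L)"
      unfolding qD_def gram_form_D_mat[OF i] steps[OF i]
      using i by (simp add: w_def add_divide_distrib)
    ultimately show ?thesis
      by (simp add: \<delta>_def inner_add_right)
  qed
  have "\<delta> N = (\<Sum>i=1..N. lam i * (\<delta> i - \<delta> (i - 1))) + (\<Sum>i=0..N. tau i * \<delta> i)"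
    using Lambda_telescope[OF Lam assms(1)] by simp
  also have "\<dots> \<le> (\<Sum>i=1..N. lam i * - (qA i / L)) + (\<Sum>i=0..N. tau i * (- (qD i / L) - inner (g i) \<nu>))"
    using Lam by (intro add_mono sum_mono mult_left_mono ineqA ineqD) (auto simp: Lambda_def)
  also have "\<dots> = - ((\<Sum>i=1..N. lam i * qA i) + (\<Sum>i=0..N. tau i * qD i)) / L
      - inner (\<Sum>i=0..N. tau i *\<^sub>R g i) \<nu>"
    by (simp add: sum_negf sum_subtractf right_diff_distrib inner_sum_left
        diff_divide_distrib flip: sum_divide_distrib)
  also have "\<dots> \<le> L * t / 2 * (norm \<nu>)\<^sup>2"
  proof -
    have "0 \<le> gram_form (N + 2) (dq_block N h lam tau t) w"
      using psd dq_block_carrier by (rule psd_imp_gram_form_nonneg)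
    also have "\<dots> = (\<Sum>i=1..N. lam i * qA i) + (\<Sum>i=0..N. tau i * qD i) +
        L * inner (\<Sum>i=0..N. tau i *\<^sub>R g i) \<nu> + L * (L * t / 2 * (norm \<nu>)\<^sup>2)"
    proof -
      have "(\<Sum>i=0..N. tau i *\<^sub>R w i) = (\<Sum>i=0..N. tau i *\<^sub>R g i)"
        by (intro sum.cong) (auto simp: w_def)
      moreover have "w (N + 1) = L *\<^sub>R \<nu>"
        by (simp add: w_def)
      ultimately show ?thesis
        unfolding gram_form_dq_block qA_def[symmetric] qD_def[symmetric]
        by (simp add: power_mult_distrib power2_eq_square)
    qed
    finally show ?thesis
      using \<open>0 < L\<close> by (simp add: field_simps)
  qed
  also have "\<dots> \<le> L * t / 2 * R\<^sup>2"
    using dist dq_feasible_nonneg[OF feas] \<open>0 < L\<close>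
    by (intro mult_left_mono power_mono) (auto simp: \<nu>_def)
  finally show ?thesis
    by (simp add: \<delta>_def mult_ac)
qed

theorem proposition4p2:
  fixes N :: nat and L R :: real and h :: "nat \<Rightarrow> nat \<Rightarrow> real"
    and f :: "real ^ 'd \<Rightarrow> real" and fstar :: real
    and xstar :: "real ^ 'd" and x :: "nat \<Rightarrow> real ^ 'd"
  assumes "N \<ge> 1" and "L > 0" and "R > 0"
    and "f \<in> C11 L" and "convex_on UNIV f"
    and "\<forall>y. fstar \<le> f y" and "f xstar = fstar"
    and "norm (xstar - x 0) \<le> R"
    and "\<forall>i<N. x (i + 1) = x i - (1 / L) *\<^sub>R (\<Sum>k=0..i. h (i + 1) k *\<^sub>R grad f (x k))"
    and "dq_solvable N h"
  shows "f (x N) - fstar \<le> L * R\<^sup>2 * dq_val N h"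
proof -
  obtain z where z: "is_arg_min dq_objective (\<lambda>z. z \<in> dq_feasible N h) z"
    using assms(10) by (auto simp: dq_solvable_def)
  obtain lam tau t where zt: "z = (lam, tau, t)"
    by (cases z)
  have "dq_val N h = dq_objective z"
    unfolding dq_val_def using z
    by (intro cInf_eq_minimum) (auto simp: is_arg_min_def not_less)
  then have "dq_val N h = t / 2"
    by (simp add: zt dq_objective_def)
  moreover have "(lam, tau, t) \<in> dq_feasible N h"
    using z by (simp add: zt is_arg_min_def)
  ultimately show ?thesis
    using first_order_bound[of N L f xstar x R h lam tau t] assms by auto
qed

end
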